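(* Let $p$ be an odd prime and $z\in\mathbb{F}_p$ with $z\neq0,-4$. Let $r=\frac{-z-2\pm\sqrt{z^2+4z}}{2}\in\mathbb{F}_{p^2}$ (either choice of square root). Then the multiplicative order of $r$ in $\mathbb{F}_{p^2}^*$ equals $\alpha(z,p)$.
   Context: $\mathbb{F}$ is an algebraic closure of $\mathbb{F}_p$. For $x,y\in\mathbb{F}$, $[i,j]:=x^{p^i}y^{p^j}-x^{p^j}y^{p^i}$ and, for $x,y$ linearly independent over $\mathbb{F}_p$, $\nu(x,y):=-\frac{[0,2][1,3]}{[0,1][2,3]}$. For $m\ge1$, $\mathcal{Z}(m)=\{\nu(x,y):x,y\in\mathbb{F}_{p^m}\text{ lin. indep. over }\mathbb{F}_p\}$, $f_{m,p}(X)=\prod_{w\in\mathcal{Z}(m)\setminus\{0\}}(X-w)$; $\alpha(z,p)$ is the least $m\ge1$ with $f_{m,p}(z)=0$. *)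

theory Defs
  imports
    "HOL-Computational_Algebra.Computational_Algebra"
    "HOL-Algebra.Multiplicative_Group"
    "HOL-Algebra.Algebraic_Closure_Type"
begin

text \<open>
  The algebraically closed field is the carrier type \<open>'a\<close>. It is an algebraic closure of the field with \<open>p\<close>
  elements if \<open>p\<close> is prime, \<open>'a :: alg_closed_field\<close>, \<open>CHAR('a) = p\<close> and every element of \<open>'a\<close> is
  algebraic over the prime field. The definitions below take \<open>p\<close> as a parameter and have their
  intended meaning only if \<open>p = CHAR('a)\<close>.
\<close>

definition prime_field :: "'a::field set" where
  "prime_field = range of_int"

definition algebraic_over_prime_field :: "'a::field \<Rightarrow> bool" where
  "algebraic_over_prime_field x \<longleftrightarrow>
     (\<exists>q :: 'a poly. q \<noteq> 0 \<and> (\<forall>i. coeff q i \<in> prime_field) \<and> poly q x = 0)"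

text \<open>
  The subfield with \<open>p ^ m\<close> elements inside the algebraic closure, as the fixed field of the
  \<open>m\<close>-th power of the Frobenius map. That it is closed under the field operations, has \<open>p ^ m\<close>
  elements, and is the only subfield with \<open>p ^ m\<close> elements is proved below.
\<close>
definition GF :: "nat \<Rightarrow> nat \<Rightarrow> 'a::field set" where
  "GF p m = {x. x ^ (p ^ m) = x}"

definition GF_units :: "nat \<Rightarrow> nat \<Rightarrow> 'a::field monoid" where
  "GF_units p m = \<lparr>carrier = GF p m - {0}, monoid.mult = (*), one = 1\<rparr>"

definition indep_prime_field :: "'a::field \<Rightarrow> 'a \<Rightarrow> bool" where
  "indep_prime_field x y \<longleftrightarrow>
     (\<forall>a\<in>prime_field. \<forall>b\<in>prime_field. a * x + b * y = 0 \<longrightarrow> a = 0 \<and> b = 0)"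

definition bracket :: "nat \<Rightarrow> 'a::field \<Rightarrow> 'a \<Rightarrow> nat \<Rightarrow> nat \<Rightarrow> 'a" where
  "bracket p x y i j = x ^ (p ^ i) * y ^ (p ^ j) - x ^ (p ^ j) * y ^ (p ^ i)"

definition nu :: "nat \<Rightarrow> 'a::field \<Rightarrow> 'a \<Rightarrow> 'a" where
  "nu p x y = - ((bracket p x y 0 2 * bracket p x y 1 3) /
                 (bracket p x y 0 1 * bracket p x y 2 3))"

definition Z_set :: "nat \<Rightarrow> nat \<Rightarrow> 'a::field set" where
  "Z_set p m = {nu p x y | x y. x \<in> GF p m \<and> y \<in> GF p m \<and> indep_prime_field x y}"

definition f_poly :: "nat \<Rightarrow> nat \<Rightarrow> 'a::field poly" where
  "f_poly p m = (\<Prod>w\<in>Z_set p m - {0}. [:- w, 1:])"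

definition alpha :: "nat \<Rightarrow> 'a::field \<Rightarrow> nat" where
  "alpha p z = (LEAST m. m \<ge> 1 \<and> poly (f_poly p m) z = 0)"

lemma zero_in_GF: "p > 0 \<Longrightarrow> (0::'a::field) \<in> GF p m"
  by (simp add: GF_def)

lemma one_in_GF: "(1::'a::field) \<in> GF p m"
  by (simp add: GF_def)

lemma mult_in_GF: "x \<in> GF p m \<Longrightarrow> y \<in> GF p m \<Longrightarrow> x * y \<in> GF p m"
  by (simp add: GF_def power_mult_distrib)

lemma inverse_in_GF: "x \<in> GF p m \<Longrightarrow> inverse x \<in> GF p m"
  by (simp add: GF_def power_inverse)

lemma add_in_GF:
  fixes x y :: "'a::field"
  assumes "prime p" "CHAR('a) = p" "x \<in> GF p m" "y \<in> GF p m"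
  shows "x + y \<in> GF p m"
  using freshmans_dream'[of "p ^ m" m x y] assms by (simp add: GF_def)

lemma uminus_in_GF:
  fixes x :: "'a::field"
  assumes "prime p" "CHAR('a) = p" "x \<in> GF p m"
  shows "- x \<in> GF p m"
proof -
  have "(x + (- x)) ^ (p ^ m) = x ^ (p ^ m) + (- x) ^ (p ^ m)"
    using freshmans_dream'[of "p ^ m" m x "- x"] assms by simp
  moreover have "(x + (- x)) ^ (p ^ m) = 0"
    using assms(1) by (simp add: prime_gt_0_nat)
  ultimately have "(- x) ^ (p ^ m) = - (x ^ (p ^ m))"
    by (simp add: eq_neg_iff_add_eq_0 add.commute)
  then show ?thesis
    using assms(3) by (simp add: GF_def)
qed

lemma group_GF_units:
  assumes "p > 0"
  shows "Group.group (GF_units p m :: 'a::field monoid)"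
proof (rule groupI)
  fix x :: 'a assume "x \<in> carrier (GF_units p m)"
  then show "\<exists>y\<in>carrier (GF_units p m). y \<otimes>\<^bsub>GF_units p m\<^esub> x = \<one>\<^bsub>GF_units p m\<^esub>"
    by (intro bexI[of _ "inverse x"]) (auto simp: GF_units_def inverse_in_GF)
qed (auto simp: GF_units_def one_in_GF mult_in_GF mult.assoc)

lemma linear_factors_add_twice:
  fixes B :: "'a::field multiset"
  shows "(\<Prod>y\<in>#{#x, x#} + B. [:-y, 1:]) = [:-x, 1:] * ([:-x, 1:] * (\<Prod>y\<in>#B. [:-y, 1:]))"
  by (simp add: mult.assoc del: mult_pCons_left mult_pCons_right)

lemma poly_pderiv_double_root:
  fixes R :: "'a::field poly"
  assumes "P = [:-x, 1:] * ([:-x, 1:] * R)"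
  shows "poly (pderiv P) x = 0"
  unfolding assms pderiv_mult poly_add poly_mult by simp

lemma smult_factor_twice:
  fixes P :: "'a::field poly"
  assumes "P = smult c Q" "Q = a * (a * S)"
  shows "P = a * (a * smult c S)"
  using assms by (simp del: mult_pCons_left mult_pCons_right)

lemma mset_eq_mset_set_if_count_le_1:
  assumes "\<And>x. count A x \<le> 1"
  shows "A = mset_set (set_mset A)"
proof (rule multiset_eqI)
  fix x
  show "count A x = count (mset_set (set_mset A)) x"
  proof (cases "x \<in># A")
    case True
    then have "count A x > 0" by simp
    then have "count A x = 1" using assms[of x] by linarith
    then show ?thesis using True by simp
  qed (simp add: not_in_iff)
qed

lemma size_eq_card_if_eq_mset_set:
  assumes "A = mset_set S"
  shows "size A = card S"
  using assms by simp

lemma card_GF: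
  assumes "prime p" "CHAR('a::alg_closed_field) = p" "m \<ge> 1"
  shows "finite (GF p m :: 'a set)" and "card (GF p m :: 'a set) = p ^ m"
proof -
  define P :: "'a poly" where "P = monom 1 (p ^ m) - [:0, 1:]"
  have q: "p ^ m > 1"
    using one_less_power[OF prime_gt_1_nat[OF assms(1)], of m] assms(3) by simp
  have poly_P: "poly P x = x ^ (p ^ m) - x" for x
    by (simp add: P_def poly_monom)
  have deg: "degree P = p ^ m"
    unfolding P_def diff_conv_add_uminus
    by (subst degree_add_eq_left) (use q in \<open>auto simp: degree_monom_eq\<close>)
  have "P \<noteq> 0" using deg q by (metis degree_0 not_less_zero)
  have [simp]: "(of_nat p :: 'a) = 0"
    using assms(2) of_nat_CHAR[where ?'a = 'a] by simp
  have pd: "pderiv P = [:-1:]"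
    using assms(3) by (simp add: P_def pderiv_diff pderiv_monom pderiv_pCons power_0_left)
  obtain A where A: "size A = degree P" "P = smult (lead_coeff P) (\<Prod>x\<in>#A. [:-x, 1:])"
    using alg_closed_imp_factorization[OF \<open>P \<noteq> 0\<close>] by blast
  have roots: "GF p m = set_mset A"
  proof -
    have "poly P x = 0 \<longleftrightarrow> x \<in> set_mset A" for x
      by (subst A(2)) (use \<open>P \<noteq> 0\<close> in \<open>auto simp: poly_prod_mset\<close>)
    then show ?thesis by (auto simp: GF_def poly_P)
  qed
  have "count A x \<le> 1" for x
  proof (rule ccontr)
    assume "\<not> count A x \<le> 1"
    then have "replicate_mset 2 x \<subseteq># A"
      by (subst count_le_replicate_mset_subset_eq[symmetric]) auto
    then have "{#x, x#} \<subseteq># A" by (simp add: numeral_2_eq_2)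
    then obtain B where B: "A = {#x, x#} + B"
      unfolding mset_subset_eq_exists_conv by blast
    have "(\<Prod>y\<in>#A. [:-y, 1:]) = [:-x, 1:] * ([:-x, 1:] * (\<Prod>y\<in>#B. [:-y, 1:]))"
      unfolding B by (rule linear_factors_add_twice)
    then have "P = [:-x, 1:] * ([:-x, 1:] * smult (lead_coeff P) (\<Prod>y\<in>#B. [:-y, 1:]))"
      by (rule smult_factor_twice[OF A(2)])
    then have "poly (pderiv P) x = 0"
      by (rule poly_pderiv_double_root)
    then show False using pd by simp
  qed
  then have "A = mset_set (set_mset A)"
    by (rule mset_eq_mset_set_if_count_le_1)
  then have "size A = card (set_mset A)"
    by (rule size_eq_card_if_eq_mset_set)
  then show "card (GF p m :: 'a set) = p ^ m"
    unfolding roots using A(1) deg by simp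
  show "finite (GF p m :: 'a set)"
    unfolding roots by simp
qed

lemma GF_unique:
  fixes K :: "'a::alg_closed_field set"
  assumes "prime p" "CHAR('a) = p" "m \<ge> 1"
    and "0 \<in> K" "\<And>x y. x \<in> K \<Longrightarrow> y \<in> K \<Longrightarrow> x * y \<in> K" "card K = p ^ m"
  shows "K = GF p m"
proof -
  have pos: "p ^ m > 0" using assms(1) prime_gt_0_nat by simp
  then have fin: "finite K" using assms(6) by (metis card.infinite less_irrefl)
  have "x \<in> GF p m" if "x \<in> K" for x
  proof (cases "x = 0")
    case True
    then show ?thesis using assms(1) by (simp add: zero_in_GF prime_gt_0_nat)
  next
    case False
    have inj: "inj_on (\<lambda>y. x * y) (K - {0})"
      using False by (auto simp: inj_on_def)
    have "(\<lambda>y. x * y) ` (K - {0}) = K - {0}"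
    proof (rule card_subset_eq)
      show "finite (K - {0})" using fin by simp
      show "(\<lambda>y. x * y) ` (K - {0}) \<subseteq> K - {0}"
        using that False assms(5) by auto
      show "card ((\<lambda>y. x * y) ` (K - {0})) = card (K - {0})"
        using inj by (rule card_image)
    qed
    then have "\<Prod>(K - {0}) = (\<Prod>y\<in>K - {0}. x * y)"
      using prod.reindex[OF inj, of "\<lambda>y. y"] by simp
    also have "\<dots> = x ^ card (K - {0}) * \<Prod>(K - {0})"
      by (simp add: prod.distrib)
    finally have "x ^ card (K - {0}) = 1"
      using fin by simp
    moreover have "card K = Suc (card (K - {0}))"
      using fin assms(4) by (metis card.remove)
    ultimately have "x ^ card K = x" by simp
    then show ?thesis using assms(6) by (simp add: GF_def)
  qed
  then have "K \<subseteq> GF p m" by blast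
  then show ?thesis
    using card_GF[OF assms(1-3)] assms(6) by (metis card_subset_eq)
qed

lemma prime_field_eq_GF:
  assumes "prime p" "CHAR('a::alg_closed_field) = p"
  shows "(prime_field :: 'a set) = GF p 1"
proof (rule GF_unique[OF assms])
  show "(0::'a) \<in> prime_field"
    unfolding prime_field_def by (metis of_int_0 rangeI)
  show "x * y \<in> prime_field" if "x \<in> prime_field" "y \<in> prime_field" for x y :: 'a
    using that unfolding prime_field_def by (metis (no_types, opaque_lifting) imageE of_int_mult rangeI)
  have p0: "p > 0" using assms(1) prime_gt_0_nat by simp
  have "(prime_field :: 'a set) = of_nat ` {..<p}"
  proof safe
    fix x :: 'a assume "x \<in> prime_field"
    then obtain k where k: "x = of_int k" by (auto simp: prime_field_def)
    have "k = int p * (k div int p) + k mod int p" by simp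
    then have "(of_int k :: 'a) = of_nat p * of_int (k div int p) + of_int (k mod int p)"
      by (metis of_int_add of_int_mult of_int_of_nat_eq)
    also have "(of_nat p :: 'a) = 0" using assms(2) of_nat_CHAR[where ?'a = 'a] by simp
    finally have "x = of_nat (nat (k mod int p))"
      using k p0 by (simp add: of_nat_nat)
    moreover have "nat (k mod int p) < p"
      using p0 by (simp add: nat_less_iff)
    ultimately show "x \<in> of_nat ` {..<p}" by blast
  next
    fix n
    show "of_nat n \<in> (prime_field :: 'a set)"
      unfolding prime_field_def by (metis of_int_of_nat_eq rangeI)
  qed
  moreover have "inj_on (of_nat :: nat \<Rightarrow> 'a) {..<p}"
  proof (rule inj_onI)
    fix a b assume "a \<in> {..<p}" "b \<in> {..<p}" "(of_nat a :: 'a) = of_nat b"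
    then show "a = b"
      using assms(2)
    proof (induction a b rule: linorder_wlog)
      case (le a b)
      then have "(of_nat (b - a) :: 'a) = 0" by (simp add: of_nat_diff)
      then have "p dvd b - a"
        using of_nat_eq_0_iff_char_dvd[where ?'a = 'a, of "b - a"] assms(2) by metis
      moreover have "b - a < p" using le by auto
      ultimately have "b - a = 0" by (meson dvd_imp_le leD not_gr_zero)
      with le show ?case by simp
    qed simp
  qed
  ultimately show "card (prime_field :: 'a set) = p ^ 1"
    by (metis card_image card_lessThan power_one_right)
qed simp

text \<open>
  The library's algebraic closure of a field equal to its own prime field is algebraic over it.
\<close>
lemma algebraic_over_prime_field_alg_closure:
  fixes x :: "'k::field alg_closure"
  assumes "(UNIV :: 'k set) = range of_int"
  shows "algebraic_over_prime_field x"
proof -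
  obtain q :: "'k poly" where q: "q \<noteq> 0" "poly (map_poly to_ac q) x = 0"
    by (rule alg_closure_algebraic)
  have "coeff (map_poly to_ac q) i \<in> prime_field" for i
  proof -
    obtain k where "coeff q i = of_int k" using assms by blast
    then show ?thesis by (simp add: coeff_map_poly prime_field_def)
  qed
  moreover have "map_poly to_ac q \<noteq> 0"
    using q(1) by (subst map_poly_eq_0_iff) auto
  ultimately show ?thesis
    using q(2) unfolding algebraic_over_prime_field_def by blast
qed

end

theory Submission
  imports Defs
begin

text \<open>
  For \<open>m \<ge> 1\<close>, \<open>z\<close> lies in \<open>Z(m)\<close> if and only if \<open>r ^ m = 1\<close>.

  Since \<open>\<nu>\<close> is invariant under scaling, \<open>Z(m)\<close> consists of the values \<open>\<nu>(1, t)\<close> with \<open>t\<close> in the field with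
  \<open>p ^ m\<close> elements but not in the prime field. If \<open>z = \<nu>(1, t)\<close>, \<open>d = t ^ p - t\<close> and \<open>u = d ^ (p - 1)\<close>, then
  \<open>u ^ p = - (u + 1) / (u + 1 + z)\<close>, so Frobenius acts on the conjugates of \<open>u\<close> by a Moebius map with fixed
  points \<open>r\<close> and \<open>1 / r\<close> and multiplier \<open>r\<close>; as \<open>u ^ p ^ m = u\<close>, its \<open>m\<close>-th power fixes \<open>u\<close> and \<open>r ^ m = 1\<close>.
  If \<open>u\<close> is itself a fixed point, the same follows because \<open>u\<close> has norm 1.

  Conversely, Frobenius acts on the solutions of \<open>x ^ p ^ 2 = z * x ^ p + z * x\<close> with two eigenvalues of
  ratio \<open>r\<close>. If \<open>r ^ m = 1\<close>, its \<open>m\<close>-th power is a scalar there, so the ratio of two independent solutions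
  \<open>x, y\<close> lies in the field with \<open>p ^ m\<close> elements, and \<open>\<nu>(x, y) = z\<close>.
\<close>

section \<open>Frobenius, brackets and scaling\<close>

lemma power_prime_CHAR_diff:
  fixes x y :: "'a::field"
  assumes "prime p" "CHAR('a) = p"
  shows "(x - y) ^ p ^ k = x ^ p ^ k - y ^ p ^ k"
  using freshmans_dream'[of "p ^ k" k "x - y" y] assms by simp

lemma power_prime_CHAR_add:
  fixes x y :: "'a::field"
  assumes "prime p" "CHAR('a) = p"
  shows "(x + y) ^ p ^ k = x ^ p ^ k + y ^ p ^ k"
  using freshmans_dream'[of "p ^ k" k x y] assms by simp

lemma power_prime_CHAR_minus:
  fixes x :: "'a::field"
  assumes "prime p" "CHAR('a) = p"
  shows "(- x) ^ p ^ k = - (x ^ p ^ k)"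
  using power_prime_CHAR_diff[OF assms, of 0 x k] prime_gt_0_nat[OF assms(1)] by simp

lemma prime_field_power_eq:
  fixes z :: "'a::alg_closed_field"
  assumes "prime p" "CHAR('a) = p" "z \<in> prime_field"
  shows "z ^ p ^ k = z"
proof (induction k)
  case (Suc k)
  have "z ^ p = z"
    using assms(3) unfolding prime_field_eq_GF[OF assms(1,2)] by (simp add: GF_def)
  with Suc show ?case by (simp add: power_mult)
qed simp

lemma bracket_shift:
  fixes x y :: "'a::field"
  assumes "prime p" "CHAR('a) = p"
  shows "bracket p x y (i + k) (j + k) = bracket p x y i j ^ p ^ k"
  by (simp add: bracket_def power_prime_CHAR_diff[OF assms] power_mult_distrib power_add power_mult)

text \<open>Frobenius shifts both indices of a bracket by one, so [1,3] and [2,3] are powers of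
  [0,2] and [0,1].\<close>

lemma nu_eq:
  fixes x y :: "'a::field"
  assumes "prime p" "CHAR('a) = p"
  shows "nu p x y = - (bracket p x y 0 2 * bracket p x y 0 2 ^ p /
                       (bracket p x y 0 1 * bracket p x y 0 1 ^ p ^ 2))"
  using bracket_shift[OF assms, of x y 0 1 2] bracket_shift[OF assms, of x y 0 2 1]
  by (simp add: nu_def numeral_3_eq_3 numeral_2_eq_2)

lemma bracket_scale:
  fixes x y c :: "'a::field"
  shows "bracket p (c * x) (c * y) i j = c ^ (p ^ i + p ^ j) * bracket p x y i j"
  by (simp add: bracket_def power_mult_distrib power_add algebra_simps)

text \<open>Numerator and denominator each carry the indices 0, 1, 2, 3 exactly once, so both scale
  by the same power \<open>C\<close> of \<open>c\<close>.\<close>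

lemma nu_scale:
  fixes x y c :: "'a::field"
  assumes "c \<noteq> 0"
  shows "nu p (c * x) (c * y) = nu p x y"
proof -
  define C where "C = c ^ (p ^ 0 + p ^ 1 + p ^ 2 + p ^ 3)"
  have [simp]: "C \<noteq> 0" using assms by (simp add: C_def)
  have "bracket p (c * x) (c * y) 0 2 * bracket p (c * x) (c * y) 1 3 =
        C * (bracket p x y 0 2 * bracket p x y 1 3)"
    unfolding bracket_scale C_def by (simp add: power_add algebra_simps)
  moreover have "bracket p (c * x) (c * y) 0 1 * bracket p (c * x) (c * y) 2 3 =
        C * (bracket p x y 0 1 * bracket p x y 2 3)"
    unfolding bracket_scale C_def by (simp add: power_add algebra_simps)
  ultimately show ?thesis unfolding nu_def by simp
qed

section \<open>Z(m) through a single parameter\<close>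

lemma indep_prime_field_iff:
  fixes x y :: "'a::alg_closed_field"
  assumes p: "prime p" "CHAR('a) = p"
  shows "indep_prime_field x y \<longleftrightarrow> x \<noteq> 0 \<and> y / x \<notin> prime_field"
proof
  have one: "(1::'a) \<in> prime_field" and zero: "(0::'a) \<in> prime_field"
    unfolding prime_field_eq_GF[OF p] using p by (auto simp: one_in_GF zero_in_GF prime_gt_0_nat)
  assume indep: "indep_prime_field x y"
  have "x \<noteq> 0"
    using indep one zero unfolding indep_prime_field_def by (metis add_0 mult_zero_left mult_zero_right one_neq_zero)
  moreover have "y / x \<notin> prime_field"
  proof
    assume "y / x \<in> prime_field"
    then have "- (y / x) \<in> prime_field"
      unfolding prime_field_eq_GF[OF p] by (rule uminus_in_GF[OF p])
    moreover have "- (y / x) * x + 1 * y = 0" using \<open>x \<noteq> 0\<close> by simp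
    ultimately show False
      using indep one unfolding indep_prime_field_def by (metis one_neq_zero)
  qed
  ultimately show "x \<noteq> 0 \<and> y / x \<notin> prime_field" by blast
next
  assume xy: "x \<noteq> 0 \<and> y / x \<notin> prime_field"
  show "indep_prime_field x y"
    unfolding indep_prime_field_def
  proof (intro ballI impI)
    fix a b :: 'a
    assume ab: "a \<in> prime_field" "b \<in> prime_field" "a * x + b * y = 0"
    have "b = 0"
    proof (rule ccontr)
      assume b: "b \<noteq> 0"
      with ab(3) xy have "y / x = - a * inverse b"
        by (simp add: field_simps) (metis add.commute eq_neg_iff_add_eq_0 mult.commute)
      moreover have "- a * inverse b \<in> prime_field"
        using ab unfolding prime_field_eq_GF[OF p]
        by (intro mult_in_GF inverse_in_GF uminus_in_GF[OF p])
      ultimately show False using xy by simp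
    qed
    with ab xy show "a = 0 \<and> b = 0" by simp
  qed
qed

lemma Z_set_eq:
  assumes p: "prime p" "CHAR('a::alg_closed_field) = p"
  shows "(Z_set p m :: 'a set) = nu p 1 ` (GF p m - prime_field)"
proof (intro equalityI subsetI)
  fix w :: 'a assume "w \<in> Z_set p m"
  then obtain x y where w: "w = nu p x y" and xy: "x \<in> GF p m" "y \<in> GF p m" "indep_prime_field x y"
    unfolding Z_set_def by blast
  then have "x \<noteq> 0" "y / x \<notin> prime_field"
    using indep_prime_field_iff[OF p] by auto
  moreover have "y / x \<in> GF p m"
    using xy by (simp add: divide_inverse mult_in_GF inverse_in_GF)
  moreover have "w = nu p 1 (y / x)"
    using nu_scale[of x p 1 "y / x"] \<open>x \<noteq> 0\<close> w by simp
  ultimately show "w \<in> nu p 1 ` (GF p m - prime_field)" by blast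
next
  fix w :: 'a assume "w \<in> nu p 1 ` (GF p m - prime_field)"
  then obtain t where "w = nu p 1 t" "t \<in> GF p m" "t \<notin> prime_field" by blast
  then show "w \<in> Z_set p m"
    unfolding Z_set_def using one_in_GF[of p m] indep_prime_field_iff[OF p, of 1 t] by auto
qed

lemma poly_f_poly_eq_0_iff:
  fixes z :: "'a::alg_closed_field"
  assumes p: "prime p" "CHAR('a) = p" and "m \<ge> 1" "z \<noteq> 0"
  shows "poly (f_poly p m) z = 0 \<longleftrightarrow> z \<in> Z_set p m"
proof -
  \<comment> \<open>A product over an infinite set defaults to 1, so finiteness is what gives
    \<open>f_poly\<close> its roots.\<close>
  have "finite (Z_set p m :: 'a set)"
    unfolding Z_set_eq[OF p] using card_GF(1)[OF p \<open>m \<ge> 1\<close>] by simp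
  then show ?thesis
    using \<open>z \<noteq> 0\<close> by (auto simp: f_poly_def poly_prod)
qed

section \<open>From membership in Z(m) to r ^ m = 1\<close>

text \<open>The Moebius map \<open>u \<mapsto> - (u + 1) / (u + 1 + z)\<close> fixes \<open>r\<close> and \<open>r' = 1 / r\<close>, with multiplier \<open>r\<close>.\<close>

lemma moebius_step:
  fixes u v z r r' :: "'a::field"
  assumes rr: "r * r' = 1" "r + r' = - z - 2" and uv: "v * (u + 1 + z) = - (u + 1)"
  shows "(v - r) * (u + 1 + z) = - (1 + r) * (u - r)"
proof -
  have "r * r + r * z + 2 * r + 1 = r * (r + r') - r * r' + r * z + 2 * r + 1"
    by (simp add: algebra_simps)
  then have r2: "r * r + r * z + 2 * r + 1 = 0" unfolding rr by (simp add: algebra_simps)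
  have "(v - r) * (u + 1 + z) = - (u + 1) - r * (u + 1 + z)"
    using uv by (simp add: left_diff_distrib)
  also have "\<dots> = - (1 + r) * (u - r) - (r * r + r * z + 2 * r + 1)"
    by (simp add: algebra_simps)
  also have "\<dots> = - (1 + r) * (u - r)"
    unfolding r2 by simp
  finally show ?thesis .
qed

text \<open>In the coordinate \<open>(w - r) / (w - r')\<close> the map is multiplication by
  \<open>r\<close>; denominators are cleared so that the value \<open>r'\<close> is allowed.\<close>

lemma moebius_iterate:
  fixes u :: "nat \<Rightarrow> 'a::field"
  assumes rr: "r * r' = 1" "r + r' = - z - 2" and z: "z \<noteq> 0"
    and u: "\<And>k. u (Suc k) * (u k + 1 + z) = - (u k + 1)"
  shows "(u k - r) * (u 0 - r') = r ^ k * ((u 0 - r) * (u k - r'))"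
proof (induction k)
  case (Suc k)
  define e where "e = u k + 1 + z"
  \<comment> \<open>At the pole the recurrence would force \<open>u k = - 1\<close> as well, hence
    \<open>z = 0\<close>.\<close>
  have e: "e \<noteq> 0"
  proof
    assume "e = 0"
    moreover have "u k + 1 = - (u (Suc k) * e)" unfolding e_def u by simp
    ultimately have "u k + 1 = 0" by simp
    with \<open>e = 0\<close> z show False by (simp add: e_def)
  qed
  have s: "(u (Suc k) - r) * e = - (1 + r) * (u k - r)"
    unfolding e_def by (rule moebius_step[OF rr u])
  have s': "(u (Suc k) - r') * e = - (1 + r') * (u k - r')"
    unfolding e_def using rr by (intro moebius_step[OF _ _ u, of r' r]) (simp_all add: ac_simps)
  \<comment> \<open>The multiplier is \<open>(1 + r) / (1 + r') = r\<close>.\<close>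
  have r: "1 + r = r * (1 + r')" using rr(1) by (simp add: algebra_simps)
  have "((u (Suc k) - r) * (u 0 - r')) * e = - (1 + r) * ((u k - r) * (u 0 - r'))"
    using s by (simp add: mult.commute mult.left_commute)
  also have "\<dots> = - (r * (1 + r')) * (r ^ k * ((u 0 - r) * (u k - r')))"
    unfolding Suc r[symmetric] ..
  also have "\<dots> = r ^ Suc k * ((u 0 - r) * (- (1 + r') * (u k - r')))"
    by (simp only: power_Suc mult_minus_left mult_minus_right ac_simps)
  also have "\<dots> = (r ^ Suc k * ((u 0 - r) * (u (Suc k) - r'))) * e"
    unfolding s'[symmetric] by (simp only: ac_simps)
  finally show ?case using e by simp
qed simp

text \<open>Each Frobenius step multiplies \<open>d\<close> by the same factor, because that factor
  is itself Frobenius-fixed. This serves the fixed points of the Moebius map.\<close>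

lemma power_eq_1_if_frobenius_eigenvector:
  fixes d r :: "'a::field"
  assumes d: "d \<noteq> 0" "d ^ p ^ m = d" and r: "d ^ p = r * d" "r ^ p = r"
  shows "r ^ m = 1"
proof -
  have "d ^ p ^ k = r ^ k * d" for k
  proof (induction k)
    case (Suc k)
    have "d ^ p ^ Suc k = (d ^ p ^ k) ^ p" by (simp only: power_Suc2 power_mult)
    also have "\<dots> = (r ^ p) ^ k * d ^ p"
      unfolding Suc by (simp add: power_mult_distrib power_commutes flip: power_mult)
         (simp add: mult.commute)
    finally show ?case using r by simp
  qed simp
  from this[of m] d show ?thesis by simp
qed

lemma power_eq_1_if_in_Z_set:
  fixes z r r' :: "'a::alg_closed_field"
  assumes p: "prime p" "CHAR('a) = p" and z: "z \<in> prime_field" "z \<noteq> 0"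
    and rr: "r * r' = 1" "r + r' = - z - 2" "r \<noteq> r'"
    and "z \<in> Z_set p m"
  shows "r ^ m = 1"
proof -
  obtain t where t: "z = nu p 1 t" "t \<in> GF p m" "t \<notin> prime_field"
    using \<open>z \<in> Z_set p m\<close> unfolding Z_set_eq[OF p] by blast
  define d where "d = t ^ p - t"
  have d0: "d \<noteq> 0"
    using t(3) unfolding prime_field_eq_GF[OF p] by (simp add: d_def GF_def)
  have dm: "d ^ p ^ m = d"
    using t(2) unfolding d_def power_prime_CHAR_diff[OF p] GF_def
    by (simp add: power_mult[symmetric] mult.commute[of p]) (simp add: power_mult)
  have b1: "bracket p 1 t 0 1 = d" by (simp add: bracket_def d_def)
  have "d ^ p = t ^ p ^ 2 - t ^ p"
    using power_prime_CHAR_diff[OF p, of "t ^ p" t 1]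
    by (simp add: d_def power2_eq_square power_mult)
  then have b2: "bracket p 1 t 0 2 = d ^ p + d" by (simp add: bracket_def d_def)
  have "(d ^ p + d) ^ p = d ^ p ^ 2 + d ^ p"
    using power_prime_CHAR_add[OF p, of "d ^ p" d 1] by (simp add: power2_eq_square power_mult)
  then have zd: "z * (d * d ^ p ^ 2) = - ((d ^ p + d) * (d ^ p ^ 2 + d ^ p))"
    using d0 unfolding t(1) nu_eq[OF p] b1 b2 by simp
  define u where "u k = (d ^ p / d) ^ p ^ k" for k
  have u0: "u 0 = d ^ p / d" by (simp add: u_def)
  have u1: "u 1 = d ^ p ^ 2 / d ^ p"
    by (simp add: u_def power_divide power2_eq_square power_mult)
  \<comment> \<open>Collecting the terms with \<open>d ^ p ^ 2\<close> in \<open>zd\<close> and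
    dividing by \<open>d * d ^ p\<close> gives the Moebius relation.\<close>
  have base: "u 1 * (u 0 + 1 + z) = - (u 0 + 1)"
  proof -
    have "d ^ p ^ 2 * (d ^ p + d + z * d) = - ((d ^ p + d) * d ^ p)"
      using zd by (simp add: algebra_simps)
    moreover have "u 0 + 1 + z = (d ^ p + d + z * d) / d" "u 0 + 1 = (d ^ p + d) / d"
      using d0 by (simp_all add: u0 add_divide_distrib)
    ultimately show ?thesis using d0 unfolding u1 by (simp add: minus_divide_left)
  qed
  have step: "u (Suc k) * (u k + 1 + z) = - (u k + 1)" for k
  proof -
    have "u (Suc k) * (u k + 1 + z) = (u 1 * (u 0 + 1 + z)) ^ p ^ k"
      using prime_field_power_eq[OF p z(1), of k]
      by (simp add: power_mult_distrib power_prime_CHAR_add[OF p] u_def flip: power_mult)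
    also have "\<dots> = - (u k + 1)"
      unfolding base power_prime_CHAR_minus[OF p] power_prime_CHAR_add[OF p]
      by (simp add: u_def)
    finally show ?thesis .
  qed
  have fixed: "q ^ m = 1" if q: "u 0 = q" "q * q' = 1" "q + q' = - z - 2" for q q'
  proof (rule power_eq_1_if_frobenius_eigenvector[OF d0 dm])
    show "d ^ p = q * d" using q(1) d0 unfolding u0 by (simp add: field_simps)
    have "u 0 + 1 + z \<noteq> 0"
      using base z(2) by (metis add_0 mult_zero_right neg_equal_0_iff_equal)
    moreover have "(u 1 - q) * (u 0 + 1 + z) = 0"
      using moebius_step[OF q(2,3) base] q(1) by simp
    ultimately have "u 1 = q" by simp
    then show "q ^ p = q" using q(1) by (simp add: u_def)
  qed
  show ?thesis
  proof (cases "u 0 = r \<or> u 0 = r'")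
    case True
    then show ?thesis
    proof
      assume "u 0 = r'"
      then have "r' ^ m = 1" using rr by (intro fixed[of r' r]) (simp_all add: ac_simps)
      moreover have "r ^ m * r' ^ m = 1" using rr(1) by (simp flip: power_mult_distrib)
      ultimately show ?thesis by simp
    qed (use fixed rr in blast)
  next
    case False
    \<comment> \<open>Periodicity of \<open>u\<close> lets both nonzero factors cancel from the
      iteration formula.\<close>
    have "u m = (d ^ p ^ m) ^ p / d ^ p ^ m"
      by (simp add: u_def power_divide mult.commute flip: power_mult)
    then have "u m = u 0" unfolding dm u0 .
    with moebius_iterate[of r r' z u m, OF rr(1,2) z(2) step] False show ?thesis by simp
  qed
qed

section \<open>From r ^ m = 1 to membership in Z(m)\<close>

lemma exists_root_trinomial:
  fixes a b :: "'a::alg_closed_field"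
  assumes "n > 1"
  shows "\<exists>x. x ^ n = a * x + b"
proof -
  have "degree (monom 1 n + [:- b, - a:]) = n"
    using assms by (subst degree_add_eq_left) (auto simp: degree_monom_eq)
  then obtain x where "poly (monom 1 n + [:- b, - a:]) x = 0"
    using alg_closed_imp_poly_has_root[of "monom 1 n + [:- b, - a:]"] assms by auto
  then show ?thesis by (intro exI[of _ x]) (simp add: poly_monom algebra_simps)
qed

lemma exists_power_eq_mult:
  fixes c :: "'a::alg_closed_field"
  assumes "n > 1" "c \<noteq> 0"
  shows "\<exists>x. x \<noteq> 0 \<and> x ^ n = c * x"
proof -
  obtain x where x: "x ^ (n - 1) = c" using nth_root_exists[of "n - 1" c] assms by auto
  have "x ^ n = c * x" using x assms(1) by
    (metis One_nat_def Suc_pred less_imp_Suc_add mult.commute power_Suc zero_less_Suc)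
  then show ?thesis using x assms by (metis power_0_left zero_less_diff less_numeral_extra(3))
qed

text \<open>
  The eigenvalues of the Frobenius map on the solution space of \<open>x ^ p ^ 2 = z * x ^ p + z * x\<close> are
  the roots \<open>r * l\<close> and \<open>l\<close> of \<open>X ^ 2 - z * X - z\<close>, where \<open>l = z / (1 + r)\<close>.
\<close>

lemma power_prime_power_scalar:
  fixes x z r r' :: "'a::field"
  assumes p: "prime p" "CHAR('a) = p" and zp: "z ^ p = z" and z: "z \<noteq> 0"
    and rr: "r * r' = 1" "r + r' = - z - 2" "r \<noteq> r'"
    and rm: "r ^ m = 1" and x: "x ^ p ^ 2 = z * x ^ p + z * x"
  shows "x ^ p ^ m = (z / (1 + r)) ^ m * x"
proof -
  define l where "l = z / (1 + r)"
  have r1: "1 + r \<noteq> 0"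
  proof
    assume "1 + r = 0"
    then have "r = - 1" by (simp add: add_eq_0_iff)
    with rr(1) have "r' = - 1" by (simp add: minus_equation_iff)
    with \<open>r = - 1\<close> rr(3) show False by simp
  qed
  have "r \<noteq> 1" using rr by auto
  have l0: "l \<noteq> 0" using r1 z by (simp add: l_def)
  have zl: "z = l * (1 + r)" using r1 by (simp add: l_def)
  then have sum: "z = l + r * l" by (simp add: algebra_simps)
  \<comment> \<open>The eigenvalue product \<open>r * l * l\<close> equals \<open>- z\<close>
    because \<open>(1 + r) * (1 + r) = - (r * z)\<close>.\<close>
  have "(1 + r) * (1 + r) = r * (r + r') - r * r' + 2 * r + 1" by (simp add: algebra_simps)
  then have "(1 + r) * (1 + r) = - (r * z)" unfolding rr by (simp add: algebra_simps)
  moreover have "z * z = l * l * ((1 + r) * (1 + r))"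
    unfolding zl by (simp only: ac_simps)
  ultimately have "- (r * (l * l)) * z = z * z" by (simp add: ac_simps)
  then have prod: "z = - (r * (l * l))" using z by (metis mult_right_cancel)
  \<comment> \<open>\<open>A\<close> and \<open>B\<close> are fitted to the initial values
    \<open>x\<close> and \<open>x ^ p\<close> of a linear recurrence with characteristic roots
    \<open>r * l\<close> and \<open>l\<close>.\<close>
  define B where "B = (x ^ p - r * l * x) / (l - r * l)"
  define A where "A = x - B"
  have ne: "l - r * l \<noteq> 0" using l0 \<open>r \<noteq> 1\<close> by (simp add: field_simps)
  have xp: "x ^ p = A * (r * l) + B * l"
  proof -
    have "B * (l - r * l) = x ^ p - r * l * x" using ne by (simp add: B_def)
    then show ?thesis by (simp add: A_def algebra_simps)
  qed
  have rec: "x ^ p ^ Suc (Suc k) = z * x ^ p ^ Suc k + z * x ^ p ^ k" for k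
  proof -
    have zk: "z ^ p ^ k = z" for k
      by (induction k) (simp_all add: power_mult zp)
    have "x ^ p ^ Suc (Suc k) = (x ^ p ^ 2) ^ p ^ k"
      by (simp add: power2_eq_square mult.assoc flip: power_mult)
    then show ?thesis
      unfolding x power_prime_CHAR_add[OF p] power_mult_distrib zk
      by (simp flip: power_mult)
  qed
  have "x ^ p ^ k = A * (r * l) ^ k + B * l ^ k \<and>
        x ^ p ^ Suc k = A * (r * l) ^ Suc k + B * l ^ Suc k" for k
  proof (induction k)
    case 0
    show ?case using xp by (simp add: A_def)
  next
    case (Suc k)
    have q: "z * w + z = w * w" if "w = l \<or> w = r * l" for w
    proof -
      have "z * w + z = (l + r * l) * w + - (r * (l * l))" by (metis sum prod)
      then show ?thesis using that by (auto simp: algebra_simps)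
    qed
    have "x ^ p ^ Suc (Suc k) = A * (r * l) ^ k * (z * (r * l) + z) + B * l ^ k * (z * l + z)"
      unfolding rec using Suc by (simp add: algebra_simps)
    also have "\<dots> = A * (r * l) ^ Suc (Suc k) + B * l ^ Suc (Suc k)"
      by (simp add: q)
    finally show ?case using Suc by blast
  qed
  from this[of m] show ?thesis
    using rm by (simp add: A_def l_def[symmetric] power_mult_distrib algebra_simps)
qed

lemma in_Z_set_if_power_eq_1:
  fixes z r r' :: "'a::alg_closed_field"
  assumes p: "prime p" "CHAR('a) = p" and z: "z \<in> prime_field" "z \<noteq> 0"
    and rr: "r * r' = 1" "r + r' = - z - 2" "r \<noteq> r'"
    and rm: "r ^ m = 1"
  shows "z \<in> Z_set p m"
proof -
  have p1: "p > 1" using p(1) by (rule prime_gt_1_nat)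
  have zp: "z ^ p = z" using prime_field_power_eq[OF p z(1), of 1] by simp
  \<comment> \<open>If \<open>x ^ p = v * x\<close>, then
    \<open>x ^ p ^ 2 = v ^ (p + 1) * x\<close>, so the equation for \<open>x\<close> reduces to this
    one.\<close>
  obtain v where v: "v ^ (p + 1) = z * v + z"
    using exists_root_trinomial[of "p + 1" z z] p1 by auto
  have "v \<noteq> 0" using v z(2) by auto
  then obtain x where x0: "x \<noteq> 0" and xp: "x ^ p = v * x"
    using exists_power_eq_mult[OF p1] by blast
  have "x ^ p ^ 2 = (x ^ p) ^ p" by (simp add: power2_eq_square power_mult)
  also have "\<dots> = v ^ (p + 1) * x" by (simp add: xp power_mult_distrib)
  finally have x: "x ^ p ^ 2 = z * x ^ p + z * x" by (simp only: v xp) (simp add: algebra_simps)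
  \<comment> \<open>The bracket [0,1] of two solutions satisfies this equation. A nonzero
    \<open>D\<close> is fixed first; solving [0,1] = \<open>D\<close> for \<open>y\<close> then
    yields a second, independent solution.\<close>
  obtain D where D0: "D \<noteq> 0" and D: "D ^ p = - z * D"
    using exists_power_eq_mult[OF p1, of "- z"] z(2) by auto
  obtain y where "y ^ p = (x ^ p / x) * y + D / x"
    using exists_root_trinomial[OF p1] by blast
  then have y: "x * y ^ p - x ^ p * y = D" using x0 by (simp add: field_simps)
  have "x ^ p * y ^ p ^ 2 - x ^ p ^ 2 * y ^ p = D ^ p"
    unfolding y[symmetric] using power_prime_CHAR_diff[OF p, of "x * y ^ p" "x ^ p * y" 1]
    by (simp add: power_mult_distrib power2_eq_square power_mult)
  moreover have "D ^ p = - z * (x * y ^ p - x ^ p * y)" unfolding y by (rule D)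
  ultimately have "x ^ p * y ^ p ^ 2 = x ^ p * (z * y ^ p + z * y)"
    unfolding x by (simp add: algebra_simps)
  then have yy: "y ^ p ^ 2 = z * y ^ p + z * y" using x0 by simp
  have b1: "bracket p x y 0 1 = D" using y by (simp add: bracket_def)
  have b2: "bracket p x y 0 2 = z * D"
    using x yy unfolding y[symmetric] by (simp add: bracket_def algebra_simps)
  have "D ^ p ^ 2 = (- (z * D)) ^ p" using D by (simp add: power2_eq_square power_mult)
  also have "\<dots> = - (z * D ^ p)"
    using power_prime_CHAR_minus[OF p, of "z * D" 1] by (simp add: power_mult_distrib zp)
  finally have "nu p x y = z"
    unfolding nu_eq[OF p] b1 b2 using D0 z(2) by (simp add: power_mult_distrib zp)
  then have "nu p 1 (y / x) = z"
    using nu_scale[of x p 1 "y / x"] x0 by simp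
  moreover have "y / x \<in> GF p m"
  proof -
    define c where "c = (z / (1 + r)) ^ m"
    note scalar = power_prime_power_scalar[OF p zp z(2) rr rm, folded c_def]
    have "c \<noteq> 0"
      using scalar[OF x] x0 by auto
    then show ?thesis
      unfolding GF_def by (simp add: power_divide scalar[OF x] scalar[OF yy])
  qed
  \<comment> \<open>A ratio in the prime field would make the bracket \<open>D\<close>
    vanish.\<close>
  moreover have "y / x \<notin> prime_field"
  proof
    assume "y / x \<in> prime_field"
    then have "(y / x) ^ p = y / x" using prime_field_power_eq[OF p, of "y / x" 1] by simp
    then have "D = 0" using x0 unfolding y[symmetric] by (simp add: power_divide field_simps)
    with D0 show False ..
  qed
  ultimately show ?thesis unfolding Z_set_eq[OF p] by blast
qed

section \<open>The order of r in the quadratic extension\<close>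

lemma reciprocal_pair_power_square:
  fixes r r' z :: "'a::field"
  assumes p: "prime p" "CHAR('a) = p" and zp: "(- z - 2) ^ p = - z - 2"
    and rr: "r * r' = 1" "r + r' = - z - 2"
  shows "r ^ p ^ 2 = r"
proof -
  have sum: "r ^ p + r' ^ p = r + r'"
    using power_prime_CHAR_add[OF p, of r r' 1] zp rr(2) by simp
  have prod: "r ^ p * r' ^ p = 1" using rr(1) by (simp flip: power_mult_distrib)
  \<comment> \<open>Frobenius permutes the two roots of X^2 + (z + 2) X + 1, so its square fixes
    \<open>r\<close>.\<close>
  have "(r ^ p - r) * (r ^ p - r') = r ^ p * (r ^ p - (r + r')) + r * r'"
    by (simp add: algebra_simps)
  also have "\<dots> = 0" unfolding sum[symmetric] using rr(1) prod by (simp add: algebra_simps)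
  finally have "r ^ p = r \<or> r ^ p = r'" by simp
  moreover have "r' ^ p = r" if "r ^ p = r'" using sum that by simp
  ultimately show ?thesis by (auto simp: power2_eq_square power_mult)
qed

lemma nat_pow_GF_units: "x [^]\<^bsub>GF_units p m\<^esub> (n::nat) = x ^ n"
  by (induction n) (simp_all add: GF_units_def nat_pow_def)

theorem theorem9p9:
  fixes p :: nat and z s r :: "'a::alg_closed_field"
  assumes "prime p" and "odd p"
    and "CHAR('a) = p" and "\<forall>x::'a. algebraic_over_prime_field x"
    and "z \<in> prime_field" and "z \<noteq> 0" and "z \<noteq> - 4"
    and "s ^ 2 = z ^ 2 + 4 * z"
    and "r = (- z - 2 + s) / 2 \<or> r = (- z - 2 - s) / 2"
  shows "r \<in> carrier (GF_units p 2) \<and> group.ord (GF_units p 2) r = alpha p z"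
proof -
  note p = \<open>prime p\<close> \<open>CHAR('a) = p\<close>
  have two: "(2::'a) \<noteq> 0"
  proof
    assume "(2::'a) = 0"
    then have "p dvd 2"
      using of_nat_eq_0_iff_char_dvd[where ?'a = 'a, of 2] p(2) by simp
    with \<open>prime p\<close> \<open>odd p\<close> show False
      using prime_nat_iff two_is_prime_nat by blast
  qed
  \<comment> \<open>The other root of the same quadratic, which turns out to be 1 / r.\<close>
  define r' where "r' = - z - 2 - r"
  have sum: "r + r' = - z - 2" by (simp add: r'_def)
  have "2 * r = - z - 2 + s \<or> 2 * r = - z - 2 - s"
    using assms(9) two by (metis nonzero_mult_div_cancel_left times_divide_eq_right)
  then have "2 * r + z + 2 = s \<or> 2 * r + z + 2 = - s" by auto
  then have s: "(2 * r + z + 2) ^ 2 = z ^ 2 + 4 * z"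
    using assms(8) by (metis power2_minus)
  have "4 * (r * r') = (z + 2) ^ 2 - (2 * r + z + 2) ^ 2"
    by (simp add: r'_def power2_eq_square algebra_simps)
  also have "\<dots> = 2 * 2 * 1" unfolding s by (simp add: power2_eq_square algebra_simps)
  finally have "2 * (2 * (r * r')) = 2 * (2 * 1)" by simp
  then have prod: "r * r' = 1" using two by (metis mult_left_cancel)
  \<comment> \<open>A double root would make the discriminant z (z + 4) vanish.\<close>
  have "r \<noteq> r'"
  proof
    assume "r = r'"
    then have eq0: "2 * r + z + 2 = 0" using sum by (simp add: algebra_simps)
    from s have "z * (z + 4) = 0" unfolding eq0 by (simp add: power2_eq_square algebra_simps)
    with \<open>z \<noteq> 0\<close> \<open>z \<noteq> - 4\<close> show False by (simp add: add_eq_0_iff2)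
  qed
  note rr = prod sum this
  obtain k where "z = of_int k"
    using \<open>z \<in> prime_field\<close> by (auto simp: prime_field_def)
  then have "- z - 2 = of_int (- k - 2)" by simp
  then have "- z - 2 \<in> prime_field" unfolding prime_field_def by (rule range_eqI)
  then have "r ^ p ^ 2 = r"
    using prime_field_power_eq[OF p, of "- z - 2" 1]
    by (intro reciprocal_pair_power_square[OF p _ rr(1,2)]) simp
  moreover have "r \<noteq> 0" using prod by auto
  ultimately have r: "r \<in> carrier (GF_units p 2)" by (simp add: GF_units_def GF_def)
  interpret G: Group.group "GF_units p 2 :: 'a monoid"
    using group_GF_units prime_gt_0_nat[OF p(1)] by blast
  have ord: "r ^ n = 1 \<longleftrightarrow> G.ord r dvd n" for n
    using G.pow_eq_id[OF r, of n] by (simp add: nat_pow_GF_units) (simp add: GF_units_def)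
  have "finite (carrier (GF_units p 2 :: 'a monoid))"
    using card_GF(1)[OF p, of 2] by (simp add: GF_units_def)
  then have "G.ord r \<ge> 1" using r by (rule G.ord_ge_1)
  \<comment> \<open>The admissible \<open>m\<close> are the positive multiples of the order, and the
    least of these is the order itself.\<close>
  moreover have "poly (f_poly p m) z = 0 \<longleftrightarrow> G.ord r dvd m" if "m \<ge> 1" for m
    using poly_f_poly_eq_0_iff[OF p that \<open>z \<noteq> 0\<close>] ord
      power_eq_1_if_in_Z_set[OF p \<open>z \<in> prime_field\<close> \<open>z \<noteq> 0\<close> rr]
      in_Z_set_if_power_eq_1[OF p \<open>z \<in> prime_field\<close> \<open>z \<noteq> 0\<close> rr] by blast
  ultimately have "alpha p z = G.ord r"
    unfolding alpha_def by (intro Least_equality) (auto intro: dvd_imp_le)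
  with r show ?thesis by simp
qed

end
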